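(* Let $X,Y\in\mathbb{R}^{m\times n}$, $Q\in\mathbb{R}^{m\times r}$, $Q_x$, $\widetilde S_x$, $\widetilde S_y$, $\widehat S_x$ and the DMD matrix $A$ be as in the context. Let $(\lambda_i,Q_xw_i)$ be a Ritz pair of $A$ via the orthonormal basis $Q_x$, i.e. $Q_x^TAQ_xw_i=\lambda_iw_i$ with $w_i\neq\mathbf{0}$, and let $r_i=AQ_xw_i-\lambda_iQ_xw_i$ be its residual. Then $$\|r_i\|_2=\begin{cases}\|\widetilde S_y\widetilde S_x^\dagger w_i-\lambda_iw_i\|_2=0,&\text{if }Q=Q_x,\\[2mm] \left\|\widetilde S_y\widehat S_x^\dagger w_i-\lambda_i\begin{pmatrix}w_i\\0\end{pmatrix}\right\|_2=\|\widetilde y_r\widehat S_x^\dagger w_i\|_2,&\text{if }Q=(Q_x\;\;q),\end{cases}$$ where $\widetilde y_r$ denotes the last ($r$-th) row of $\widetilde S_y$.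
   Context: $M^\dagger$ denotes the Moore–Penrose pseudoinverse. Let $S=(\mathbf{s}_1\;\cdots\;\mathbf{s}_{n+1})\in\mathbb{R}^{m\times(n+1)}$ be a matrix of snapshots from a single trajectory, and set $X=S(:,1:n)$, $Y=S(:,2:n+1)$. Assume $S=Q\widetilde S$ with $Q\in\mathbb{R}^{m\times r}$ having orthonormal columns and $\widetilde S\in\mathbb{R}^{r\times(n+1)}$. Put $\widetilde S_x=\widetilde S(:,1:n)$ and $\widetilde S_y=\widetilde S(:,2:n+1)$, so $X=Q\widetilde S_x$ and $Y=Q\widetilde S_y$. The factorization is built so that exactly one of the following two situations holds: (i) the last row of $\widetilde S_x$ is nonzero and $\widetilde S_x$ has full row rank $r$; then $\mathrm{range}(X)=\mathrm{range}(Q)$ and one sets $Q_x=Q$; (ii) the last row of $\widetilde S_x$ is zero, $\widetilde S_x=\begin{pmatrix}\widehat S_x\\ \mathbf{0}\end{pmatrix}$ with $\widehat S_x\in\mathbb{R}^{(r-1)\times n}$ of full row rank; then one sets $Q_x=Q(:,1:r-1)$, whose columns form an orthonormal basis of $\mathrm{range}(X)$, and $Q=(Q_x\;\;q)$ where $q$ is the last column of $Q$. A DMD matrix is any matrix $A\in\mathbb{R}^{m\times m}$ minimizing $\|AX-Y\|_F$; equivalently $AX=YP_{\mathcal{R}(X^T)}$, where $P_{\mathcal{R}(X^T)}$ is the orthogonal projector onto the range of $X^T$. Eigenpairs $(\lambda_i,w_i)$ may be complex. *)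

theory Defs
  imports "Jordan_Normal_Form.DL_Rank" "Jordan_Normal_Form.Char_Poly" Complex_Main
begin

text \<open>Columns \<open>a, \<dots>, b - 1\<close> (counted from 0), so that \<open>M(:,1:k)\<close> is \<open>col_slice M 0 k\<close> and
  \<open>M(:,2:k+1)\<close> is \<open>col_slice M 1 (Suc k)\<close>.\<close>

definition col_slice :: "'a mat \<Rightarrow> nat \<Rightarrow> nat \<Rightarrow> 'a mat" where
  "col_slice M a b = mat (dim_row M) (b - a) (\<lambda>(i, j). M $$ (i, a + j))"

definition orthonormal_cols :: "real mat \<Rightarrow> bool" where
  "orthonormal_cols Q \<longleftrightarrow>
     (\<forall>i < dim_col Q. \<forall>j < dim_col Q. col Q i \<bullet> col Q j = (if i = j then 1 else 0))"

text \<open>\<open>vec_space.rank\<close> takes the number of rows (the dimension of the space containing the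
  columns) as an explicit argument.\<close>

definition full_row_rank :: "real mat \<Rightarrow> bool" where
  "full_row_rank M \<longleftrightarrow> vec_space.rank (dim_row M) M = dim_row M"

text \<open>The four Penrose equations, which have exactly one solution for every real matrix.\<close>

definition is_pinv :: "real mat \<Rightarrow> real mat \<Rightarrow> bool" where
  "is_pinv M P \<longleftrightarrow>
     P \<in> carrier_mat (dim_col M) (dim_row M) \<and>
     M * P * M = M \<and> P * M * P = P \<and>
     (M * P)\<^sup>T = M * P \<and> (P * M)\<^sup>T = P * M"

definition pinv :: "real mat \<Rightarrow> real mat" where
  "pinv M = (THE P. is_pinv M P)"

lemma is_pinv_unique:
  assumes P: "is_pinv M P" and R: "is_pinv M R"
  shows "P = R"
proof -
  obtain a b where M: "M \<in> carrier_mat a b" by blast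
  have Pc: "P \<in> carrier_mat b a" and Rc: "R \<in> carrier_mat b a"
    using P R M unfolding is_pinv_def by auto
  note c = M Pc Rc mult_carrier_mat[OF M Pc] mult_carrier_mat[OF M Rc]
    mult_carrier_mat[OF Pc M] mult_carrier_mat[OF Rc M]
  have p: "M * P * M = M" "P * M * P = P" "(M * P)\<^sup>T = M * P" "(P * M)\<^sup>T = P * M"
    and q: "M * R * M = M" "R * M * R = R" "(M * R)\<^sup>T = M * R" "(R * M)\<^sup>T = R * M"
    using P R unfolding is_pinv_def by auto
  have "M * P = M * R * M * P" using q(1) by simp
  also have "\<dots> = (M * R) * (M * P)" by (rule assoc_mult_mat) (use c in auto)
  also have "\<dots> = (M * R)\<^sup>T * (M * P)\<^sup>T" using p(3) q(3) by simp
  also have "\<dots> = ((M * P) * (M * R))\<^sup>T" using c by (intro transpose_mult[symmetric]) auto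
  also have "(M * P) * (M * R) = M * P * M * R"
    by (rule assoc_mult_mat[symmetric]) (use c in auto)
  finally have 1: "M * P = M * R" using p(1) q(3) by simp
  have "P * M = P * (M * R * M)" using q(1) by simp
  also have "\<dots> = (P * M) * (R * M)" using c by (simp add: assoc_mult_mat[of M a b R a M b] assoc_mult_mat[of P b a M b "R * M" b])
  also have "\<dots> = (P * M)\<^sup>T * (R * M)\<^sup>T" using p(4) q(4) by simp
  also have "\<dots> = ((R * M) * (P * M))\<^sup>T" using c by (intro transpose_mult[symmetric]) auto
  also have "(R * M) * (P * M) = R * (M * P * M)"
    using c by (simp add: assoc_mult_mat[of M a b P a M b] assoc_mult_mat[of R b a M b "P * M" b])
  finally have 2: "P * M = R * M" using p(1) q(4) by simp
  have "P = R * M * P" using p(2) 2 by simp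
  also have "\<dots> = R * (M * P)" by (rule assoc_mult_mat) (use c in auto)
  also have "\<dots> = R * M * R" unfolding 1 by (rule assoc_mult_mat[symmetric]) (use c in auto)
  finally show ?thesis using q(2) by simp
qed

lemma pinv_eqI: "is_pinv M P \<Longrightarrow> pinv M = P"
  unfolding pinv_def by (blast intro: is_pinv_unique)

definition frobenius_norm :: "real mat \<Rightarrow> real" where
  "frobenius_norm M = sqrt (\<Sum>i < dim_row M. \<Sum>j < dim_col M. (M $$ (i, j))\<^sup>2)"

definition dmd_matrix :: "real mat \<Rightarrow> real mat \<Rightarrow> real mat \<Rightarrow> bool" where
  "dmd_matrix X Y A \<longleftrightarrow>
     A \<in> carrier_mat (dim_row Y) (dim_row X) \<and>
     (\<forall>B \<in> carrier_mat (dim_row Y) (dim_row X).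
        frobenius_norm (A * X - Y) \<le> frobenius_norm (B * X - Y))"

definition norm2 :: "complex vec \<Rightarrow> real" where
  "norm2 v = sqrt (\<Sum>i < dim_vec v. (cmod (v $ i))\<^sup>2)"

text \<open>Real matrices act on complex Ritz vectors through this embedding.\<close>

abbreviation cmat :: "real mat \<Rightarrow> complex mat" where
  "cmat M \<equiv> map_mat complex_of_real M"

text \<open>\<open>(lam, V w)\<close> is a Ritz pair of \<open>A\<close> via the orthonormal basis given by the columns of \<open>V\<close>;
  the arguments are \<open>lam\<close> and the coordinate vector \<open>w\<close>.\<close>

definition ritz_pair :: "real mat \<Rightarrow> real mat \<Rightarrow> complex \<Rightarrow> complex vec \<Rightarrow> bool" where
  "ritz_pair A V lam w \<longleftrightarrow> eigenvector (cmat (V\<^sup>T * A * V)) w lam"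

definition ritz_residual :: "real mat \<Rightarrow> real mat \<Rightarrow> complex \<Rightarrow> complex vec \<Rightarrow> complex vec" where
  "ritz_residual A V lam w = cmat A *\<^sub>v (cmat V *\<^sub>v w) - lam \<cdot>\<^sub>v (cmat V *\<^sub>v w)"

end

theory Submission
  imports Defs
begin

text \<open>Write \<open>X = Q\<^sub>x Z\<close> with \<open>Z\<close> of full row rank. Although a DMD matrix \<open>A\<close> is not unique, minimality
  forces \<open>A Q\<^sub>x = Y Z\<^sup>\<dagger> = Q S\<^sub>y Z\<^sup>\<dagger>\<close>. Hence the residual is \<open>Q u\<close> for a coordinate vector \<open>u\<close>, so its
  norm is that of \<open>u\<close>, and the Ritz condition says exactly that the coordinates of \<open>u\<close>
  belonging to \<open>Q\<^sub>x\<close> vanish.\<close>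

section \<open>Full row rank: right inverses and the pseudoinverse\<close>

text \<open>A maximal independent set of columns has \<open>k\<close> elements, the rank, and is
  therefore a basis of the \<open>k\<close>-dimensional space; all the columns then span at least as
  much.\<close>

lemma span_cols_full_row_rank:
  assumes Z: "Z \<in> carrier_mat k n" and full: "full_row_rank Z"
  shows "LinearCombinations.module.span class_ring (module_vec TYPE(real) k) (set (cols Z)) = carrier_vec k"
proof -
  interpret vec_space "TYPE(real)" k .
  have sub: "set (cols Z) \<subseteq> carrier_vec k" using Z cols_dim by blast
  obtain S where S: "maximal S (\<lambda>T. T \<subseteq> set (cols Z) \<and> lin_indpt T)" "finite S"
    using maximal_exists_superset[of "set (cols Z)" "\<lambda>T. T \<subseteq> set (cols Z) \<and> lin_indpt T" "{}"]
      finite_lin_indpt2[of "{}"] by auto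
  have "card S = k"
    using rank_card_indpt[OF Z S(1)] full Z unfolding full_row_rank_def by auto
  moreover have "S \<subseteq> set (cols Z)" "lin_indpt S" using S(1) by (auto simp: maximal_def)
  ultimately have "basis S"
    using dim_li_is_basis[OF fin_dim S(2)] sub dim_is_n by auto
  then have "span S = carrier_vec k" by (simp add: basis_def)
  then show ?thesis
    using span_is_monotone[OF \<open>S \<subseteq> set (cols Z)\<close>] span_is_subset2[OF sub] by auto
qed

text \<open>Each unit vector is a linear combination of the columns of \<open>Z\<close>; the
  coefficient vectors become the columns of \<open>R\<close>.\<close>

lemma full_row_rank_right_inverse:
  assumes Z: "Z \<in> carrier_mat k n" and full: "full_row_rank Z"
  obtains R where "R \<in> carrier_mat n k" "Z * R = 1\<^sub>m k"
proof -
  interpret vec_space "TYPE(real)" k .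
  have sub: "set (cols Z) \<subseteq> carrier_vec k" using Z cols_dim by blast
  have "\<exists>x. x \<in> carrier_vec n \<and> Z *\<^sub>v x = unit_vec k i" for i
  proof -
    have "unit_vec k i \<in> span_list (cols Z)"
      using span_cols_full_row_rank[OF Z full] span_list_as_span[OF sub] by auto
    then obtain c where "unit_vec k i = lincomb_list c (cols Z)"
      unfolding span_list_def by auto
    also have "\<dots> = mat_of_cols k (cols Z) *\<^sub>v vec (length (cols Z)) c"
      by (rule lincomb_list_as_mat_mult) (use sub in auto)
    finally show ?thesis using Z by (intro exI[of _ "vec n c"]) auto
  qed
  then obtain x where x: "x i \<in> carrier_vec n" "Z *\<^sub>v x i = unit_vec k i" for i by metis
  define R where "R = mat_of_cols n (map x [0..<k])"
  have R: "R \<in> carrier_mat n k" by (auto simp: R_def)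
  have "Z * R = 1\<^sub>m k"
  proof (rule mat_col_eqI)
    fix i assume "i < dim_col (1\<^sub>m k :: real mat)"
    then have i: "i < k" by simp
    then have "col R i = x i" unfolding R_def using x(1) by (subst col_mat_of_cols) auto
    then show "col (Z * R) i = col (1\<^sub>m k) i" using col_mult2[OF Z R i] x(2) i by simp
  qed (use Z R in auto)
  with R that show ?thesis by blast
qed

text \<open>The inner product of \<open>v\<close> with \<open>Z * Z\<^sup>T *\<^sub>v v\<close> is
  the squared length of \<open>Z\<^sup>T *\<^sub>v v\<close>, which over the reals vanishes only for
  the zero vector.\<close>

lemma gram_kernel:
  fixes Z :: "real mat"
  assumes Z: "Z \<in> carrier_mat k n" and v: "v \<in> carrier_vec k"
    and zero: "(Z * Z\<^sup>T) *\<^sub>v v = 0\<^sub>v k"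
  shows "Z\<^sup>T *\<^sub>v v = 0\<^sub>v n"
proof -
  have c: "Z\<^sup>T *\<^sub>v v \<in> carrier_vec n" using Z v by auto
  have "(Z\<^sup>T *\<^sub>v v) \<bullet> (Z\<^sup>T *\<^sub>v v) = v \<bullet> (Z *\<^sub>v (Z\<^sup>T *\<^sub>v v))"
    using transpose_vec_mult_scalar[OF Z c v] .
  also have "\<dots> = 0"
    using zero assoc_mult_mat_vec[of Z k n "Z\<^sup>T" k v] Z v by auto
  finally show ?thesis
    using conjugate_square_eq_0_vec[OF c] by (simp add: vec_conjugate_real)
qed

text \<open>The Gram matrix \<open>Z * Z\<^sup>T\<close> is invertible with inverse
  \<open>H\<close>, and the explicit formula \<open>Z\<^sup>T * H\<close> satisfies the Penrose
  equations; uniqueness identifies it with \<open>pinv Z\<close>.\<close>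

lemma full_row_rank_pinv:
  assumes Z: "Z \<in> carrier_mat k n" and full: "full_row_rank Z"
  shows "is_pinv Z (pinv Z)" "Z * pinv Z = 1\<^sub>m k"
proof -
  obtain R where R: "R \<in> carrier_mat n k" "Z * R = 1\<^sub>m k"
    using full_row_rank_right_inverse[OF Z full] .
  have G: "Z * Z\<^sup>T \<in> carrier_mat k k" using Z by auto
  \<comment> \<open>Transposing \<open>Z * R = 1\<close> makes \<open>R\<^sup>T\<close> a left
    inverse of \<open>Z\<^sup>T\<close>, so \<open>Z\<^sup>T\<close> is injective and the Gram
    matrix inherits a trivial kernel.\<close>
  have inj: "v = 0\<^sub>v k" if v: "v \<in> carrier_vec k" "(Z * Z\<^sup>T) *\<^sub>v v = 0\<^sub>v k" for v
  proof -
    have "v = (Z * R)\<^sup>T *\<^sub>v v" using v R by simp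
    also have "\<dots> = R\<^sup>T *\<^sub>v (Z\<^sup>T *\<^sub>v v)"
      using v Z R(1) by (simp add: transpose_mult[OF Z R(1)] assoc_mult_mat_vec[of _ k n _ k])
    finally show ?thesis using gram_kernel[OF Z v] R(1) by auto
  qed
  have "det (Z * Z\<^sup>T) \<noteq> 0" using det_0_iff_vec_prod_zero_field[OF G] inj by blast
  from det_non_zero_imp_unit[OF G this]
  obtain H where H: "H \<in> carrier_mat k k" "Z * Z\<^sup>T * H = 1\<^sub>m k" "H * (Z * Z\<^sup>T) = 1\<^sub>m k"
    unfolding Units_def ring_mat_def by auto
  define P where "P = Z\<^sup>T * H"
  have P: "P \<in> carrier_mat n k" unfolding P_def using Z H(1) by auto
  have ZP: "Z * P = 1\<^sub>m k"
    using assoc_mult_mat[of Z k n "Z\<^sup>T" k H k] Z H(1,2) by (simp add: P_def)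
  have GT: "(Z * Z\<^sup>T)\<^sup>T = Z * Z\<^sup>T" using Z by (simp add: transpose_mult[of Z k n "Z\<^sup>T" k])
  have "H\<^sup>T * (Z * Z\<^sup>T) = 1\<^sub>m k"
    using transpose_mult[OF G H(1)] GT H(2) by simp
  \<comment> \<open>\<open>H\<^sup>T\<close> is a left inverse and \<open>H\<close> a right inverse
    of the same symmetric matrix, so they agree. This symmetry gives the Penrose condition on
    \<open>P * Z\<close>.\<close>
  then have "H\<^sup>T = H"
    using H(1,2) G assoc_mult_mat[of "H\<^sup>T" k k "Z * Z\<^sup>T" k H k] by simp
  then have "(P * Z)\<^sup>T = P * Z"
    unfolding P_def using Z H(1)
    by (simp add: transpose_mult[of "Z\<^sup>T" n k "H * Z" n] transpose_mult[of H k k Z n]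
        assoc_mult_mat[of "Z\<^sup>T" n k H k Z n])
  moreover have "P * Z * P = P" using assoc_mult_mat[OF P Z P] ZP P by simp
  ultimately have "is_pinv Z P" using P Z ZP by (simp add: is_pinv_def)
  with pinv_eqI[OF this] ZP show "is_pinv Z (pinv Z)" "Z * pinv Z = 1\<^sub>m k" by auto
qed

section \<open>Frobenius norm and least squares minimizers\<close>

lemma frobenius_norm_sq:
  "(frobenius_norm M)\<^sup>2 = (\<Sum>i<dim_row M. row M i \<bullet> row M i)"
proof -
  have "(frobenius_norm M)\<^sup>2 = (\<Sum>i<dim_row M. \<Sum>j<dim_col M. (M $$ (i, j))\<^sup>2)"
    unfolding frobenius_norm_def by (intro real_sqrt_pow2 sum_nonneg) auto
  then show ?thesis
    by (auto simp: scalar_prod_def power2_eq_square atLeast0LessThan intro!: sum.cong)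
qed

text \<open>Pythagoras applied row by row: the diagonal entries of \<open>M * N\<^sup>T\<close> are
  the inner products of corresponding rows, so the cross terms vanish.\<close>

lemma frobenius_norm_sq_add:
  assumes M: "M \<in> carrier_mat a b" and N: "N \<in> carrier_mat a b" and orth: "M * N\<^sup>T = 0\<^sub>m a a"
  shows "(frobenius_norm (M + N))\<^sup>2 = (frobenius_norm M)\<^sup>2 + (frobenius_norm N)\<^sup>2"
proof -
  have "row (M + N) i \<bullet> row (M + N) i = row M i \<bullet> row M i + row N i \<bullet> row N i" if i: "i < a" for i
  proof -
    have r: "row M i \<in> carrier_vec b" "row N i \<in> carrier_vec b" using M N by auto
    have "row M i \<bullet> row N i = (M * N\<^sup>T) $$ (i, i)" using M N i by simp
    then have "row M i \<bullet> row N i = 0" using orth i by simp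
    moreover have "row N i \<bullet> row M i = row M i \<bullet> row N i" using comm_scalar_prod[OF r(2,1)] .
    moreover have "row (M + N) i = row M i + row N i" using M N i by auto
    ultimately show ?thesis
      using r by (simp add: add_scalar_prod_distrib[of _ b] scalar_prod_add_distrib[of _ b])
  qed
  then show ?thesis
    using M N by (simp add: frobenius_norm_sq sum.distrib)
qed

lemma frobenius_norm_eq_0:
  assumes "M \<in> carrier_mat a b" "frobenius_norm M = 0"
  shows "M = 0\<^sub>m a b"
proof (rule eq_matI)
  fix i j assume "i < dim_row (0\<^sub>m a b :: real mat)" "j < dim_col (0\<^sub>m a b :: real mat)"
  moreover have "(\<Sum>i<a. \<Sum>j<b. (M $$ (i, j))\<^sup>2) = 0"
    using assms by (simp add: frobenius_norm_def)
  then have "\<forall>i<a. (\<Sum>j<b. (M $$ (i, j))\<^sup>2) = 0"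
    by (subst (asm) sum_nonneg_eq_0_iff) (auto intro: sum_nonneg)
  then have "\<forall>i<a. \<forall>j<b. M $$ (i, j) = 0"
    by (subst (asm) sum_nonneg_eq_0_iff) auto
  ultimately show "M $$ (i, j) = 0\<^sub>m a b $$ (i, j)" by simp
qed (use assms in auto)

text \<open>With \<open>P = pinv Z\<close>, the competitor \<open>Y P V\<^sup>T\<close> has residual \<open>Y P Z - Y\<close>, which is orthogonal
  to the row space of \<open>Z\<close>; by Pythagoras a minimizer cannot deviate from it on \<open>V\<close>.\<close>

lemma dmd_matrix_on_basis:
  assumes V: "V \<in> carrier_mat m k" "V\<^sup>T * V = 1\<^sub>m k"
    and Z: "Z \<in> carrier_mat k n" "full_row_rank Z"
    and Y: "Y \<in> carrier_mat l n"
    and A: "dmd_matrix (V * Z) Y A"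
  shows "A * V = Y * pinv Z"
proof -
  define P where "P = pinv Z"
  note pinv = full_row_rank_pinv[OF Z, folded P_def]
  have P: "P \<in> carrier_mat n k" and sym: "(P * Z)\<^sup>T = P * Z" and ZPZ: "Z * P * Z = Z"
    using pinv(1) Z by (auto simp: is_pinv_def)
  have Ac: "A \<in> carrier_mat l m" using A V Y by (auto simp: dmd_matrix_def)
  \<comment> \<open>\<open>D\<close> is the deviation of \<open>A\<close> on the basis
    \<open>V\<close> from the competitor's value \<open>Y * P\<close>; \<open>W\<close> is the
    residual of the competitor.\<close>
  define D where "D = A * V - Y * P"
  define W where "W = Y * P * Z - Y"
  have YP: "Y * P \<in> carrier_mat l k" and AV: "A * V \<in> carrier_mat l k" using Y P Ac V by auto
  have D: "D \<in> carrier_mat l k" unfolding D_def by (rule minus_carrier_mat[OF YP])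
  have W: "W \<in> carrier_mat l n" unfolding W_def by (rule minus_carrier_mat[OF Y])
  have DZ: "D * Z \<in> carrier_mat l n" using D Z by auto
  have split: "A * (V * Z) - Y = D * Z + W"
  proof -
    have "A * (V * Z) = A * V * Z" using assoc_mult_mat[OF Ac V(1) Z(1)] by simp
    moreover have "D * Z = A * V * Z - Y * P * Z"
      unfolding D_def by (rule minus_mult_distrib_mat[OF AV YP Z(1)])
    moreover have "M - Y = (M - N) + (N - Y)"
      if "M \<in> carrier_mat l n" "N \<in> carrier_mat l n" for M N :: "real mat"
      using that Y by (intro eq_matI) auto
    ultimately show ?thesis
      unfolding W_def using mult_carrier_mat[OF AV Z(1)] mult_carrier_mat[OF YP Z(1)] by metis
  qed
  have comp: "(Y * P * V\<^sup>T) * (V * Z) - Y = W"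
  proof -
    have "(Y * P * V\<^sup>T) * (V * Z) = Y * P * (V\<^sup>T * V * Z)"
      using YP V Z assoc_mult_mat[of "Y * P" l k "V\<^sup>T" m "V * Z" n]
        assoc_mult_mat[of "V\<^sup>T" k m V k Z n] by simp
    then show ?thesis using V Z by (simp add: W_def)
  qed
  \<comment> \<open>Symmetry of \<open>P * Z\<close> turns this product into
    \<open>Z * P * Z * Y\<^sup>T - Z * Y\<^sup>T\<close>, which vanishes since
    \<open>Z * P * Z = Z\<close>.\<close>
  have "Z * W\<^sup>T = 0\<^sub>m k l"
  proof -
    have "W = Y * (P * Z) - Y" using assoc_mult_mat[OF Y P Z(1)] by (simp add: W_def)
    then have "W\<^sup>T = P * Z * Y\<^sup>T - Y\<^sup>T"
      using Y P Z sym by (simp add: transpose_minus[of _ l n] transpose_mult[of Y l n "P * Z" n])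
    then have "Z * W\<^sup>T = Z * (P * Z * Y\<^sup>T) - Z * Y\<^sup>T"
      using P Z Y by (simp add: mult_minus_distrib_mat[of Z k n _ l])
    also have "Z * (P * Z * Y\<^sup>T) = Z * Y\<^sup>T"
      using P Z Y ZPZ assoc_mult_mat[of Z k n "P * Z" n "Y\<^sup>T" l] assoc_mult_mat[of Z k n P k Z n]
      by simp
    finally show ?thesis using Z Y by auto
  qed
  then have "D * Z * W\<^sup>T = 0\<^sub>m l l"
    using D Z W by (simp add: assoc_mult_mat[of D l k Z n "W\<^sup>T" l])
  then have "(frobenius_norm (D * Z + W))\<^sup>2 = (frobenius_norm (D * Z))\<^sup>2 + (frobenius_norm W)\<^sup>2"
    by (rule frobenius_norm_sq_add[OF DZ W])
  moreover have "frobenius_norm (D * Z + W) \<le> frobenius_norm W"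
  proof -
    have "Y * P * V\<^sup>T \<in> carrier_mat (dim_row Y) (dim_row (V * Z))" using YP V Y by auto
    then show ?thesis using A unfolding dmd_matrix_def using split comp by metis
  qed
  then have "(frobenius_norm (D * Z + W))\<^sup>2 \<le> (frobenius_norm W)\<^sup>2"
    by (rule power_mono) (auto simp: frobenius_norm_def intro!: sum_nonneg)
  ultimately have "(frobenius_norm (D * Z))\<^sup>2 \<le> 0" by linarith
  then have "frobenius_norm (D * Z) = 0" by simp
  then have "D * Z = 0\<^sub>m l n" using frobenius_norm_eq_0[OF DZ] by blast
  \<comment> \<open>Multiplying by \<open>P\<close> on the right cancels \<open>Z\<close>, because
    full row rank gives \<open>Z * P = 1\<close>.\<close>
  then have "D = 0\<^sub>m l k"
    using assoc_mult_mat[OF D Z(1) P] pinv(2) D P by simp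
  then have "A * V - Y * P + Y * P = 0\<^sub>m l k + Y * P" by (simp add: D_def)
  moreover have "M - N + N = M" if "M \<in> carrier_mat l k" "N \<in> carrier_mat l k" for M N :: "real mat"
    using that by (intro eq_matI) auto
  ultimately have "A * V = Y * P" using AV YP by (metis left_add_zero_mat)
  then show ?thesis by (simp add: P_def)
qed

section \<open>Isometries and the Ritz residual in coordinates\<close>

lemma orthonormal_cols_gram:
  assumes "Q \<in> carrier_mat m r" "orthonormal_cols Q"
  shows "Q\<^sup>T * Q = 1\<^sub>m r"
  using assms by (intro eq_matI) (auto simp: orthonormal_cols_def)

text \<open>A real matrix acts separately on real and imaginary parts, and the squared complex norm
  is the sum of the two squared real norms; each is preserved by \<open>Q\<close>.\<close>

lemma norm2_isometry:
  assumes Q: "Q \<in> carrier_mat m r" "Q\<^sup>T * Q = 1\<^sub>m r" and u: "u \<in> carrier_vec r"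
  shows "norm2 (cmat Q *\<^sub>v u) = norm2 u"
proof -
  have real: "(Q *\<^sub>v a) \<bullet> (Q *\<^sub>v a) = a \<bullet> a" if a: "a \<in> carrier_vec r" for a
  proof -
    have "(Q *\<^sub>v a) \<bullet> (Q *\<^sub>v a) = a \<bullet> (Q\<^sup>T *\<^sub>v (Q *\<^sub>v a))"
      using transpose_vec_mult_scalar[of "Q\<^sup>T" r m "Q *\<^sub>v a" a] Q a by simp
    also have "Q\<^sup>T *\<^sub>v (Q *\<^sub>v a) = a"
      using assoc_mult_mat_vec[of "Q\<^sup>T" r m Q r a] Q a by simp
    finally show ?thesis .
  qed
  have norm: "norm2 v = sqrt (map_vec Re v \<bullet> map_vec Re v + map_vec Im v \<bullet> map_vec Im v)" for v
    by (simp add: norm2_def scalar_prod_def cmod_power2 sum.distrib atLeast0LessThan flip: power2_eq_square)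
  have "map_vec Re (cmat Q *\<^sub>v u) = Q *\<^sub>v map_vec Re u"
    "map_vec Im (cmat Q *\<^sub>v u) = Q *\<^sub>v map_vec Im u"
    using Q u by (auto simp: scalar_prod_def intro!: eq_vecI)
  then show ?thesis using u by (simp add: norm real)
qed

lemma cmat_mult_vec:
  assumes "M \<in> carrier_mat a b" "N \<in> carrier_mat b c" "w \<in> carrier_vec c"
  shows "cmat (M * N) *\<^sub>v w = cmat M *\<^sub>v (cmat N *\<^sub>v w)"
  using assms by (simp add: of_real_hom.mat_hom_mult[OF assms(1,2)] assoc_mult_mat_vec[of _ a b _ c])

lemma mult_mat_vec_diff:
  fixes M :: "'a :: field mat"
  assumes "M \<in> carrier_mat a b" "x \<in> carrier_vec b" "y \<in> carrier_vec b"
  shows "M *\<^sub>v (x - c \<cdot>\<^sub>v y) = M *\<^sub>v x - c \<cdot>\<^sub>v (M *\<^sub>v y)"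
  using assms by (simp add: mult_minus_distrib_mat_vec[of _ a b] mult_mat_vec[of _ a b])

text \<open>Both situations are instances of \<open>Q\<^sub>x = Q E\<close>, with \<open>E\<close> the identity or its first
  \<open>r - 1\<close> columns.\<close>

lemma dmd_ritz_residual:
  assumes Q: "Q \<in> carrier_mat m r" "Q\<^sup>T * Q = 1\<^sub>m r"
    and E: "E \<in> carrier_mat r k" "E\<^sup>T * E = 1\<^sub>m k"
    and Z: "Z \<in> carrier_mat k n" "full_row_rank Z"
    and T: "T \<in> carrier_mat r n"
    and A: "dmd_matrix (Q * E * Z) (Q * T) A"
    and ritz: "ritz_pair A (Q * E) lam w"
  defines "u \<equiv> cmat (T * pinv Z) *\<^sub>v w - lam \<cdot>\<^sub>v (cmat E *\<^sub>v w)"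
  shows "norm2 (ritz_residual A (Q * E) lam w) = norm2 u" "cmat (E\<^sup>T) *\<^sub>v u = 0\<^sub>v k"
proof -
  have P: "pinv Z \<in> carrier_mat n k"
    using full_row_rank_pinv(1)[OF Z] Z by (auto simp: is_pinv_def)
  have QE: "Q * E \<in> carrier_mat m k" and TP: "T * pinv Z \<in> carrier_mat r k"
    and QT: "Q * T \<in> carrier_mat m n" using Q E T P by auto
  have Ac: "A \<in> carrier_mat m m" using A Q by (auto simp: dmd_matrix_def)
  have QtQE: "Q\<^sup>T * (Q * M) = M" if "M \<in> carrier_mat r c" for M c
    using assoc_mult_mat[of "Q\<^sup>T" r m Q r M c] Q that by simp
  have gram: "(Q * E)\<^sup>T * (Q * M) = E\<^sup>T * M" if M: "M \<in> carrier_mat r c" for M c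
    using assoc_mult_mat[of "E\<^sup>T" k r "Q\<^sup>T" m "Q * M" c] Q E M QtQE[OF M]
    by (simp add: transpose_mult[OF Q(1) E(1)])
  have "A * (Q * E) = Q * T * pinv Z"
    by (rule dmd_matrix_on_basis[OF QE _ Z QT A]) (simp add: gram[OF E(1)] E(2))
  then have AQE: "A * (Q * E) = Q * (T * pinv Z)" using assoc_mult_mat[OF Q(1) T P] by simp
  \<comment> \<open>The value of \<open>A\<close> on the basis lies in the range of
    \<open>Q\<close>, so \<open>Q\<^sup>T * Q = 1\<close> removes \<open>Q\<close> and the Ritz
    condition becomes an eigenvalue equation free of \<open>A\<close>.\<close>
  have "(Q * E)\<^sup>T * A * (Q * E) = E\<^sup>T * (T * pinv Z)"
    using assoc_mult_mat[of "(Q * E)\<^sup>T" k m A m "Q * E" k] QE Ac AQE gram[OF TP] by simp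
  then have ev: "eigenvector (cmat (E\<^sup>T * (T * pinv Z))) w lam"
    using ritz by (simp add: ritz_pair_def)
  then have w: "w \<in> carrier_vec k" using E by (simp add: eigenvector_def)
  have TPw: "cmat (T * pinv Z) *\<^sub>v w \<in> carrier_vec r" and Ew: "cmat E *\<^sub>v w \<in> carrier_vec r"
    using TP E w by auto
  have u: "u \<in> carrier_vec r" unfolding u_def using TPw Ew by simp
  \<comment> \<open>Both terms of the residual carry the left factor \<open>Q\<close>, an
    isometry.\<close>
  have "ritz_residual A (Q * E) lam w = cmat Q *\<^sub>v u"
    unfolding ritz_residual_def cmat_mult_vec[OF Ac QE w, symmetric] AQE u_def
    using mult_mat_vec_diff[OF _ TPw Ew, of "cmat Q" m lam] Q(1)
    by (simp add: cmat_mult_vec[OF Q(1) TP w] cmat_mult_vec[OF Q(1) E(1) w])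
  then show "norm2 (ritz_residual A (Q * E) lam w) = norm2 u" using norm2_isometry[OF Q u] by simp
  \<comment> \<open>Applying \<open>E\<^sup>T\<close> produces the projected matrix in the first
    term and, as \<open>E\<^sup>T * E = 1\<close>, just \<open>lam \<cdot>\<^sub>v w\<close> in the
    second.\<close>
  have "cmat (E\<^sup>T) *\<^sub>v u = cmat (E\<^sup>T * (T * pinv Z)) *\<^sub>v w - lam \<cdot>\<^sub>v (cmat (E\<^sup>T * E) *\<^sub>v w)"
    unfolding u_def using mult_mat_vec_diff[OF _ TPw Ew, of "cmat (E\<^sup>T)" k lam] E(1)
    by (simp add: cmat_mult_vec[OF _ TP w] cmat_mult_vec[OF _ E(1) w])
  also have "\<dots> = lam \<cdot>\<^sub>v w - lam \<cdot>\<^sub>v w"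
    using ev w E(2) by (simp add: eigenvector_def of_real_hom.mat_hom_one)
  finally show "cmat (E\<^sup>T) *\<^sub>v u = 0\<^sub>v k" using w by simp
qed

section \<open>The two situations of the factorization\<close>

lemma col_slice_mult:
  assumes "M \<in> carrier_mat a b" "N \<in> carrier_mat b c" "j \<le> c"
  shows "col_slice (M * N) i j = M * col_slice N i j"
  using assms by (intro eq_matI) (auto simp: col_slice_def scalar_prod_def)

theorem proposition4p2:
  fixes m n r :: nat
    and S Q S\<^sub>t X Y S\<^sub>x S\<^sub>y S\<^sub>h Q\<^sub>x A :: "real mat"
    and q :: "real vec"
    and lam :: complex and w :: "complex vec"
  assumes r: "1 \<le> r"
    and S: "S \<in> carrier_mat m (Suc n)"
    and Q: "Q \<in> carrier_mat m r" "orthonormal_cols Q"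
    and S\<^sub>t: "S\<^sub>t \<in> carrier_mat r (Suc n)"
    and factorization: "S = Q * S\<^sub>t"
    and X: "X = col_slice S 0 n"
    and Y: "Y = col_slice S 1 (Suc n)"
    and S\<^sub>x: "S\<^sub>x = col_slice S\<^sub>t 0 n"
    and S\<^sub>y: "S\<^sub>y = col_slice S\<^sub>t 1 (Suc n)"
    and situation:
      "(row S\<^sub>x (r - 1) \<noteq> 0\<^sub>v n \<and> full_row_rank S\<^sub>x \<and> Q\<^sub>x = Q) \<or>
       (row S\<^sub>x (r - 1) = 0\<^sub>v n \<and>
        S\<^sub>h \<in> carrier_mat (r - 1) n \<and> S\<^sub>x = S\<^sub>h @\<^sub>r 0\<^sub>m 1 n \<and> full_row_rank S\<^sub>h \<and>
        Q\<^sub>x = col_slice Q 0 (r - 1))"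
    and q: "q = col Q (r - 1)"
    and A: "dmd_matrix X Y A"
    and ritz: "ritz_pair A Q\<^sub>x lam w"
  shows
    "(Q = Q\<^sub>x \<longrightarrow>
        norm2 (ritz_residual A Q\<^sub>x lam w) = norm2 (cmat (S\<^sub>y * pinv S\<^sub>x) *\<^sub>v w - lam \<cdot>\<^sub>v w) \<and>
        norm2 (cmat (S\<^sub>y * pinv S\<^sub>x) *\<^sub>v w - lam \<cdot>\<^sub>v w) = 0) \<and>
     (Q = mat_of_cols m (cols Q\<^sub>x @ [q]) \<longrightarrow>
        norm2 (ritz_residual A Q\<^sub>x lam w) =
          norm2 (cmat (S\<^sub>y * pinv S\<^sub>h) *\<^sub>v w - lam \<cdot>\<^sub>v (w @\<^sub>v 0\<^sub>v 1)) \<and>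
        norm2 (cmat (S\<^sub>y * pinv S\<^sub>h) *\<^sub>v w - lam \<cdot>\<^sub>v (w @\<^sub>v 0\<^sub>v 1)) =
          norm2 (cmat (mat_of_rows n [row S\<^sub>y (r - 1)] * pinv S\<^sub>h) *\<^sub>v w))"
proof (intro conjI impI)
  have QQ: "Q\<^sup>T * Q = 1\<^sub>m r" by (rule orthonormal_cols_gram[OF Q])
  have S\<^sub>x_carrier: "S\<^sub>x \<in> carrier_mat r n" and S\<^sub>y_carrier: "S\<^sub>y \<in> carrier_mat r n"
    using S\<^sub>t by (auto simp: S\<^sub>x S\<^sub>y col_slice_def)
  have X': "X = Q * S\<^sub>x" and Y': "Y = Q * S\<^sub>y"
    using col_slice_mult[OF Q(1) S\<^sub>t] by (auto simp: X Y S\<^sub>x S\<^sub>y factorization)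
  {
    assume eq: "Q = Q\<^sub>x"
    \<comment> \<open>Otherwise the second situation holds and \<open>Q\<^sub>x\<close> has
      \<open>r - 1\<close> columns, fewer than \<open>Q\<close> since
      \<open>1 \<le> r\<close>.\<close>
    have full: "full_row_rank S\<^sub>x"
    proof (rule ccontr)
      assume "\<not> full_row_rank S\<^sub>x"
      then have "Q\<^sub>x = col_slice Q 0 (r - 1)" using situation by blast
      then have "dim_col Q\<^sub>x = r - 1" by (simp add: col_slice_def)
      then show False using eq Q r by auto
    qed
    have Q1: "Q * 1\<^sub>m r = Q" using Q by simp
    define u where "u = cmat (S\<^sub>y * pinv S\<^sub>x) *\<^sub>v w - lam \<cdot>\<^sub>v w"
    have w: "w \<in> carrier_vec r"
      using ritz eq Q by (auto simp: ritz_pair_def eigenvector_def)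
    have u: "u \<in> carrier_vec r" unfolding u_def carrier_vec_def using w by simp
    have dmd: "dmd_matrix (Q * 1\<^sub>m r * S\<^sub>x) (Q * S\<^sub>y) A" using A by (simp only: X' Y' Q1)
    have ritz': "ritz_pair A (Q * 1\<^sub>m r) lam w" using ritz unfolding Q1 eq[symmetric] .
    have one: "cmat (1\<^sub>m r) *\<^sub>v w = w" using w by (simp add: of_real_hom.mat_hom_one)
    note core = dmd_ritz_residual[OF Q(1) QQ one_carrier_mat _ S\<^sub>x_carrier full S\<^sub>y_carrier dmd ritz',
        unfolded one, folded u_def]
    have "norm2 (ritz_residual A Q lam w) = norm2 u"
      using core(1) by (simp add: Q1)
    \<comment> \<open>With \<open>E\<close> the identity, the vanishing of \<open>E\<^sup>T\<close>
      applied to \<open>u\<close> is the vanishing of \<open>u\<close> itself.\<close>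
    moreover have "u = 0\<^sub>v r"
      using core(2) u by (simp add: of_real_hom.mat_hom_one)
    ultimately have core: "norm2 (ritz_residual A Q\<^sub>x lam w) = norm2 u" "norm2 u = 0"
      by (simp_all add: norm2_def flip: eq)
    show "norm2 (ritz_residual A Q\<^sub>x lam w) = norm2 (cmat (S\<^sub>y * pinv S\<^sub>x) *\<^sub>v w - lam \<cdot>\<^sub>v w)"
      "norm2 (cmat (S\<^sub>y * pinv S\<^sub>x) *\<^sub>v w - lam \<cdot>\<^sub>v w) = 0"
      using core unfolding u_def .
  }
  {
    assume eq: "Q = mat_of_cols m (cols Q\<^sub>x @ [q])"
    \<comment> \<open>Appending \<open>q\<close> adds a column, so counting columns excludes the
      first situation.\<close>
    have "Q\<^sub>x \<noteq> Q"
    proof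
      assume "Q\<^sub>x = Q"
      then have "dim_col Q = Suc (dim_col Q)" using arg_cong[OF eq, of dim_col] by simp
      then show False by simp
    qed
    then have S\<^sub>h: "S\<^sub>h \<in> carrier_mat (r - 1) n" "full_row_rank S\<^sub>h"
      and S\<^sub>x_rows: "S\<^sub>x = S\<^sub>h @\<^sub>r 0\<^sub>m 1 n" and Q\<^sub>x: "Q\<^sub>x = col_slice Q 0 (r - 1)"
      using situation by auto
    obtain k where k: "r = Suc k" using r by (cases r) auto
    \<comment> \<open>\<open>E\<close> embeds the first \<open>k\<close> coordinates: on the right
      of \<open>Q\<close> it drops the last column, on the left of \<open>S\<^sub>h\<close> it
      appends a zero row, and on \<open>w\<close> it appends a zero entry.\<close>
    define E :: "real mat" where "E = mat r k (\<lambda>(i, j). if i = j then 1 else 0)"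
    have E: "E \<in> carrier_mat r k" by (simp add: E_def)
    have col_E: "col E j = unit_vec r j" if "j < k" for j
      using that by (intro eq_vecI) (auto simp: E_def unit_vec_def k)
    have row_E: "row E i = (if i < k then unit_vec k i else 0\<^sub>v k)" if "i < r" for i
      using that by (intro eq_vecI) (auto simp: E_def unit_vec_def k)
    have EE: "E\<^sup>T * E = 1\<^sub>m k"
      using E by (intro eq_matI) (auto simp: col_E k)
    have QE: "Q\<^sub>x = Q * E"
      unfolding Q\<^sub>x using Q(1) E
      by (intro eq_matI) (auto simp: col_slice_def col_E k scalar_prod_right_unit)
    have EZ: "S\<^sub>x = E * S\<^sub>h"
      unfolding S\<^sub>x_rows using S\<^sub>h(1) E
      by (intro eq_matI) (auto simp: append_rows_def row_E k scalar_prod_left_unit)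
    have X'': "X = Q * E * S\<^sub>h"
      using assoc_mult_mat[OF Q(1) E, of S\<^sub>h n] S\<^sub>h(1) by (simp add: X' EZ k)
    have w: "w \<in> carrier_vec k"
      using ritz Q E by (auto simp: ritz_pair_def eigenvector_def QE)
    define u where "u = cmat (S\<^sub>y * pinv S\<^sub>h) *\<^sub>v w - lam \<cdot>\<^sub>v (w @\<^sub>v 0\<^sub>v 1)"
    have "cmat E *\<^sub>v w = w @\<^sub>v 0\<^sub>v 1"
    proof (rule eq_vecI)
      fix i assume "i < dim_vec (w @\<^sub>v 0\<^sub>v 1)"
      then have i: "i < r" using w k by simp
      have "row (cmat E) i = (if i < k then unit_vec k i else 0\<^sub>v k)"
        using i by (intro eq_vecI) (auto simp: E_def unit_vec_def k)
      then show "(cmat E *\<^sub>v w) $ i = (w @\<^sub>v 0\<^sub>v 1) $ i"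
        using i E w k by (auto simp: scalar_prod_left_unit)
    qed (use E w k in auto)
    then have core: "norm2 (ritz_residual A Q\<^sub>x lam w) = norm2 u" "cmat (E\<^sup>T) *\<^sub>v u = 0\<^sub>v k"
      using dmd_ritz_residual[OF Q(1) QQ E EE _ S\<^sub>h(2) S\<^sub>y_carrier, of A lam w] A ritz S\<^sub>h(1)
      by (simp_all add: k X'' Y' QE u_def)
    have P: "pinv S\<^sub>h \<in> carrier_mat n k"
      using full_row_rank_pinv(1)[OF S\<^sub>h] S\<^sub>h(1) k by (auto simp: is_pinv_def)
    have u: "u \<in> carrier_vec r" unfolding u_def carrier_vec_def using w k by simp
    \<comment> \<open>\<open>E\<^sup>T\<close> reads off the first \<open>k\<close> coordinates, so
      only the entry with index \<open>k = r - 1\<close> can survive.\<close>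
    have zero: "u $ i = 0" if i: "i < k" for i
    proof -
      have "row (cmat (E\<^sup>T)) i = unit_vec r i"
        using i by (intro eq_vecI) (auto simp: E_def unit_vec_def k)
      then have "(cmat (E\<^sup>T) *\<^sub>v u) $ i = u $ i"
        using i E u k by (simp add: scalar_prod_left_unit)
      then show ?thesis using core(2) i by simp
    qed
    \<comment> \<open>Index \<open>k\<close> hits the zero appended to \<open>w\<close>, so
      \<open>lam\<close> drops out and only the last row of \<open>S\<^sub>y\<close>
      contributes.\<close>
    have last: "u $ k = (cmat (mat_of_rows n [row S\<^sub>y (r - 1)] * pinv S\<^sub>h) *\<^sub>v w) $ 0"
    proof -
      have "row (cmat (S\<^sub>y * pinv S\<^sub>h)) k =
          row (cmat (mat_of_rows n [row S\<^sub>y (r - 1)] * pinv S\<^sub>h)) 0"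
        using S\<^sub>y_carrier P k by (intro eq_vecI) auto
      then show ?thesis using S\<^sub>y_carrier P w k by (simp add: u_def)
    qed
    show "norm2 (ritz_residual A Q\<^sub>x lam w) =
        norm2 (cmat (S\<^sub>y * pinv S\<^sub>h) *\<^sub>v w - lam \<cdot>\<^sub>v (w @\<^sub>v 0\<^sub>v 1))"
      using core(1) unfolding u_def .
    have "norm2 u = cmod (u $ k)"
      using u k zero by (simp add: norm2_def)
    also have "\<dots> = norm2 (cmat (mat_of_rows n [row S\<^sub>y (r - 1)] * pinv S\<^sub>h) *\<^sub>v w)"
      unfolding last by (simp add: norm2_def)
    finally show "norm2 (cmat (S\<^sub>y * pinv S\<^sub>h) *\<^sub>v w - lam \<cdot>\<^sub>v (w @\<^sub>v 0\<^sub>v 1)) =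
        norm2 (cmat (mat_of_rows n [row S\<^sub>y (r - 1)] * pinv S\<^sub>h) *\<^sub>v w)"
      unfolding u_def .
  }
qed

end
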